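(* Let $(X_t)_{t\in\mathbb{Z}}$ be a stationary, square integrable, $\beta$-mixing sequence of real-valued random variables on a probability space $(\Omega,\mathcal{A},\mathbb{P})$, with common cumulative distribution function $F$ and mixing coefficients $\beta(n)$, $n\geq 1$. Suppose that for some $\delta\in(0,1)$, $$\beta(n)=O\left(n^{-\frac{1+\delta}{1-\delta}}\right)\quad\text{as } n\to+\infty.$$ Then $$\sup_{x\in\mathbb{R}}|F_n(x)-F(x)|\rightarrow 0\quad\text{almost surely, as } n\rightarrow+\infty.$$
   Context: For $n\ge 1$, $F_n(x)=\frac{1}{n}\sum_{i=1}^{n}\mathbb{I}_{\{X_i\leq x\}}$, $x\in\mathbb{R}$, is the empirical function, and $F(x)=\mathbb{P}(X_1\leq x)$. The $\beta$-mixing coefficient used here is $$\beta(n)=\sup_{A\in\mathcal{F}_t^{-\infty},\ B\in\mathcal{F}_{t+n}^{\infty}}\left|\mathbb{P}(A\cap B)-\mathbb{P}(A)\mathbb{P}(B)\right|,$$ where $\mathcal{F}_t^{-\infty}=\sigma(X_\ell:\ell\leq t)$ and $\mathcal{F}_{t+n}^{\infty}=\sigma(X_\ell:\ell\geq t+n)$; by stationarity this does not depend on $t\in\mathbb{Z}$. The sequence is $\beta$-mixing if $\beta(n)\to 0$ as $n\to+\infty$. Square integrable means $\mathbb{E}X_t^2<+\infty$. *)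

theory Defs
  imports "HOL-Probability.Probability" "HOL-Library.Landau_Symbols"
begin

(* Strict stationarity: the finite-dimensional distributions are invariant under time shifts. *)
definition stationary :: "'a measure \<Rightarrow> (int \<Rightarrow> 'a \<Rightarrow> real) \<Rightarrow> bool" where
  "stationary M X \<longleftrightarrow>
     (\<forall>J h. finite J \<longrightarrow>
        distr M (PiM J (\<lambda>_. borel)) (\<lambda>\<omega>. \<lambda>t\<in>J. X (t + h) \<omega>) =
        distr M (PiM J (\<lambda>_. borel)) (\<lambda>\<omega>. \<lambda>t\<in>J. X t \<omega>))"

definition generated_events :: "'a measure \<Rightarrow> (int \<Rightarrow> 'a \<Rightarrow> real) \<Rightarrow> int set \<Rightarrow> 'a set set" where
  "generated_events M X I =
     sigma_sets (space M) {X l -` S \<inter> space M | l S. l \<in> I \<and> S \<in> sets borel}"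

(* The supremum is that of a nonempty set of reals in [0, 1].
   The time t at which the past ends is kept as a parameter; under stationarity the value
   does not depend on it. Although called beta-mixing here, this is the coefficient that is
   elsewhere usually called the strong (alpha-)mixing coefficient. *)
definition beta_coeff :: "'a measure \<Rightarrow> (int \<Rightarrow> 'a \<Rightarrow> real) \<Rightarrow> int \<Rightarrow> nat \<Rightarrow> real" where
  "beta_coeff M X t n =
     (SUP (A, B) \<in> generated_events M X {..t} \<times> generated_events M X {t + int n..}.
        \<bar>measure M (A \<inter> B) - measure M A * measure M B\<bar>)"

definition beta_mixing :: "'a measure \<Rightarrow> (int \<Rightarrow> 'a \<Rightarrow> real) \<Rightarrow> int \<Rightarrow> bool" where
  "beta_mixing M X t \<longleftrightarrow> beta_coeff M X t \<longlonglongrightarrow> 0"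

definition empirical_fun :: "(int \<Rightarrow> 'a \<Rightarrow> real) \<Rightarrow> nat \<Rightarrow> real \<Rightarrow> 'a \<Rightarrow> real" where
  "empirical_fun X n x \<omega> = (1 / real n) * (\<Sum>i = 1..n. indicator {..x} (X (int i) \<omega>))"

end

theory Submission
  imports Defs "HOL-Library.Discrete_Functions"
begin

text \<open>The exponent \<open>(1 + \<delta>) / (1 - \<delta>)\<close> exceeds 1, so the mixing coefficients are summable.
  For a Borel set \<open>B\<close>, the events \<open>X i \<in> B\<close> and \<open>X j \<in> B\<close>
  belong, after a time shift, to the past and to the future, so their covariance is at most the mixing
  coefficient at lag \<open>\<bar>i - j\<bar>\<close> (\<open>stationary_covariance_le_beta_coeff\<close>).
  Hence the number of visits to \<open>B\<close> up to time \<open>n\<close> has variance of order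
  \<open>n\<close>, and its frequency has variance of order \<open>1 / n\<close>. Along the squares these
  variances are summable, which forces almost sure convergence there; the number of visits is monotone in
  \<open>n\<close>, which fills the gaps between the squares. This is the strong law
  \<open>frequency_strong_law\<close>.

  The passage from one set \<open>B\<close> to the supremum over \<open>x\<close> is the classical Glivenko-Cantelli
  argument, \<open>uniform_limit_cdf_if_at_quantiles\<close>. It is deterministic: almost surely the
  strong law holds simultaneously for the half-lines \<open>{..q}\<close> and \<open>{..<q}\<close> at all quantiles \<open>q\<close> of
  rational level, and monotonicity controls the distribution functions between neighbouring
  quantiles. Open half-lines are needed because \<open>F\<close> may jump at a quantile: only the left limit
  bounds what happens just below it.\<close>

section \<open>Covariances of events under strong mixing\<close>

text \<open>The work is to see that the supremum is over a bounded set.\<close>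

lemma (in prob_space) mixing_le_beta_coeff:
  assumes "A \<in> generated_events M X {..t}" and "B \<in> generated_events M X {t + int n..}"
  shows "\<bar>prob (A \<inter> B) - prob A * prob B\<bar> \<le> beta_coeff M X t n"
proof -
  have bound: "\<bar>prob (A \<inter> B) - prob A * prob B\<bar> \<le> 1" for A B
    using mult_le_one[OF prob_le_1[of A] measure_nonneg[of M B] prob_le_1[of B]]
      measure_nonneg[of M "A \<inter> B"] prob_le_1[of "A \<inter> B"]
      mult_nonneg_nonneg[OF measure_nonneg[of M A] measure_nonneg[of M B]]
    by linarith
  have "(\<lambda>(A, B). \<bar>prob (A \<inter> B) - prob A * prob B\<bar>) (A, B) \<le> beta_coeff M X t n"
    unfolding beta_coeff_def
  proof (rule cSUP_upper)
    show "(A, B) \<in> generated_events M X {..t} \<times> generated_events M X {t + int n..}"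
      using assms by simp
    show "bdd_above ((\<lambda>(A, B). \<bar>prob (A \<inter> B) - prob A * prob B\<bar>) `
            (generated_events M X {..t} \<times> generated_events M X {t + int n..}))"
      using bound by (intro bdd_aboveI[of _ 1]) auto
  qed
  then show ?thesis by simp
qed

lemma stationary_pair:
  fixes X :: "int \<Rightarrow> 'a \<Rightarrow> real"
  assumes meas: "\<And>l. X l \<in> borel_measurable M" and "stationary M X"
    and B: "B \<in> sets borel" and C: "C \<in> sets borel"
  shows "measure M ((X (i + h) -` B \<inter> space M) \<inter> (X (j + h) -` C \<inter> space M)) =
         measure M ((X i -` B \<inter> space M) \<inter> (X j -` C \<inter> space M))"
proof -
  let ?N = "PiM {i, j} (\<lambda>_. borel :: real measure)"
  let ?S = "{f \<in> space ?N. f i \<in> B \<and> f j \<in> C}"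
  have S: "?S \<in> sets ?N"
    using B C by measurable
  have *: "measure (distr M ?N (\<lambda>\<omega>. \<lambda>t\<in>{i, j}. X (t + g) \<omega>)) ?S =
      measure M ((X (i + g) -` B \<inter> space M) \<inter> (X (j + g) -` C \<inter> space M))" for g
  proof -
    have "(\<lambda>\<omega>. \<lambda>t\<in>{i, j}. X (t + g) \<omega>) \<in> measurable M ?N"
      using meas by (intro measurable_restrict) auto
    then show ?thesis
      using S by (subst measure_distr) (auto simp: space_PiM intro!: arg_cong[where f="measure M"])
  qed
  have "distr M ?N (\<lambda>\<omega>. \<lambda>t\<in>{i, j}. X (t + h) \<omega>) = distr M ?N (\<lambda>\<omega>. \<lambda>t\<in>{i, j}. X (t + 0) \<omega>)"
    using assms(2) unfolding stationary_def by simp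
  then show ?thesis
    using *[of h] *[of 0] by simp
qed

text \<open>The one-dimensional case is the diagonal of the two-dimensional one.\<close>

lemma stationary_single:
  fixes X :: "int \<Rightarrow> 'a \<Rightarrow> real"
  assumes "\<And>l. X l \<in> borel_measurable M" and "stationary M X" and "B \<in> sets borel"
  shows "measure M (X i -` B \<inter> space M) = measure M (X j -` B \<inter> space M)"
  using stationary_pair[OF assms(1,2,3,3), of j "i - j" j] by simp

text \<open>Stationarity moves the earlier of the two times to the time \<open>t\<close> at which the past ends. At
  lag 0 the two events coincide and lie both in the past and in the future, so the diagonal needs
  no separate treatment.\<close>

lemma (in prob_space) stationary_covariance_le_beta_coeff:
  fixes X :: "int \<Rightarrow> 'a \<Rightarrow> real"
  assumes meas: "\<And>l. X l \<in> borel_measurable M" and stat: "stationary M X"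
    and B: "B \<in> sets borel"
  shows "\<bar>prob ((X i -` B \<inter> space M) \<inter> (X (i + int d) -` B \<inter> space M))
           - prob (X i -` B \<inter> space M) * prob (X (i + int d) -` B \<inter> space M)\<bar>
         \<le> beta_coeff M X t d"
proof -
  have gen: "X l -` B \<inter> space M \<in> generated_events M X I" if "l \<in> I" for l I
    using that B unfolding generated_events_def by (intro sigma_sets.Basic) auto
  have "prob ((X i -` B \<inter> space M) \<inter> (X (i + int d) -` B \<inter> space M)) =
        prob ((X t -` B \<inter> space M) \<inter> (X (t + int d) -` B \<inter> space M))"
    using stationary_pair[OF meas stat B B, of t "i - t" "t + int d"] by (simp add: algebra_simps)
  then show ?thesis
    using mixing_le_beta_coeff[OF gen[of t "{..t}"] gen[of "t + int d" "{t + int d..}"]]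
      stationary_single[OF meas stat B, of i t]
      stationary_single[OF meas stat B, of "i + int d" "t + int d"]
    by simp
qed

section \<open>A strong law for frequencies of weakly correlated events\<close>

text \<open>Each lag occurs at most once on either side of \<open>i\<close>.\<close>

lemma sum_lag_le_suminf:
  fixes c :: "nat \<Rightarrow> real"
  assumes "summable c" and "\<And>d. 0 \<le> c d" and "finite I"
  shows "(\<Sum>j\<in>I. c (if i \<le> j then j - i else i - j)) \<le> 2 * suminf c"
proof -
  have "(\<Sum>j\<in>{j\<in>I. i \<le> j}. c (j - i)) = sum c ((\<lambda>j. j - i) ` {j\<in>I. i \<le> j})"
    by (subst sum.reindex) (auto simp: inj_on_def)
  also have "\<dots> \<le> suminf c"
    using assms by (intro sum_le_suminf) auto
  finally have later: "(\<Sum>j\<in>{j\<in>I. i \<le> j}. c (j - i)) \<le> suminf c" .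
  have "(\<Sum>j\<in>{j\<in>I. \<not> i \<le> j}. c (i - j)) = sum c ((\<lambda>j. i - j) ` {j\<in>I. \<not> i \<le> j})"
    by (subst sum.reindex) (auto simp: inj_on_def)
  also have "\<dots> \<le> suminf c"
    using assms by (intro sum_le_suminf) auto
  finally have earlier: "(\<Sum>j\<in>{j\<in>I. \<not> i \<le> j}. c (i - j)) \<le> suminf c" .
  have "(\<Sum>j\<in>I. c (if i \<le> j then j - i else i - j)) =
        (\<Sum>j\<in>I. if i \<le> j then c (j - i) else c (i - j))"
    by (intro sum.cong) auto
  also have "\<dots> = (\<Sum>j\<in>{j\<in>I. i \<le> j}. c (j - i)) + (\<Sum>j\<in>{j\<in>I. \<not> i \<le> j}. c (i - j))"
    using \<open>finite I\<close> by (simp add: sum.If_cases Int_def Compl_eq)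
  finally show ?thesis
    using later earlier by linarith
qed

text \<open>The second moment is the sum of all covariances. Each row of the covariance matrix is
  bounded by the sum of the correlation decay on both sides of the diagonal, so the second moment
  grows only linearly.\<close>

lemma (in prob_space) second_moment_frequency_le:
  fixes A :: "nat \<Rightarrow> 'a set" and c :: "nat \<Rightarrow> real"
  assumes A: "\<And>i. A i \<in> events" and p: "\<And>i. prob (A i) = p"
    and cov: "\<And>i d. \<bar>prob (A i \<inter> A (i + d)) - p * p\<bar> \<le> c d"
    and c: "summable c"
  shows "expectation (\<lambda>\<omega>. ((\<Sum>i=1..n. indicator (A i) \<omega>) - real n * p)\<^sup>2) \<le> real n * (2 * suminf c)"
proof -
  let ?Z = "\<lambda>i \<omega>. indicator (A i) \<omega> - p :: real"
  have c0: "0 \<le> c d" for d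
    using cov[of 0 d] by linarith
  have ZZ: "?Z i \<omega> * ?Z j \<omega> =
      indicator (A i \<inter> A j) \<omega> - p * indicator (A i) \<omega> - p * indicator (A j) \<omega> + p * p" for i j \<omega>
    by (simp add: indicator_inter_arith algebra_simps)
  have int: "integrable M (indicator S :: 'a \<Rightarrow> real)" if "S \<in> events" for S
    using that by (simp add: emeasure_eq_measure)
  have int_ZZ: "integrable M (\<lambda>\<omega>. ?Z i \<omega> * ?Z j \<omega>)" for i j
    unfolding ZZ using A
    by (intro Bochner_Integration.integrable_add Bochner_Integration.integrable_diff
        integrable_mult_right int) auto
  have E_ZZ: "expectation (\<lambda>\<omega>. ?Z i \<omega> * ?Z j \<omega>) = prob (A i \<inter> A j) - p * p" for i j
    unfolding ZZ using A p int[of "A i \<inter> A j"] int[OF A[of i]] int[OF A[of j]]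
    by (simp add: prob_space)
  have lag: "prob (A i \<inter> A j) - p * p \<le> c (if i \<le> j then j - i else i - j)" for i j
    using cov[of i "j - i"] cov[of j "i - j"] by (auto simp: Int_commute abs_le_iff)
  have "((\<Sum>i=1..n. indicator (A i) \<omega>) - real n * p)\<^sup>2 = (\<Sum>i=1..n. \<Sum>j=1..n. ?Z i \<omega> * ?Z j \<omega>)" for \<omega>
    by (simp add: sum_product[symmetric] power2_eq_square sum_subtractf)
  then have "expectation (\<lambda>\<omega>. ((\<Sum>i=1..n. indicator (A i) \<omega>) - real n * p)\<^sup>2) =
      (\<Sum>i=1..n. \<Sum>j=1..n. prob (A i \<inter> A j) - p * p)"
    using int_ZZ E_ZZ by simp
  also have "\<dots> \<le> (\<Sum>i=1..n. \<Sum>j=1..n. c (if i \<le> j then j - i else i - j))"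
    by (intro sum_mono lag)
  also have "\<dots> \<le> (\<Sum>i=1..n. 2 * suminf c)"
    using c c0 by (intro sum_mono sum_lag_le_suminf) auto
  finally show ?thesis by simp
qed

text \<open>By monotone convergence the sum of the \<open>Y n\<close> has finite expectation, so it is almost surely
  finite and its terms tend to 0.\<close>

lemma AE_tendsto_0_if_expectations_summable:
  fixes Y :: "nat \<Rightarrow> 'a \<Rightarrow> real"
  assumes int: "\<And>n. integrable M (Y n)" and nonneg: "\<And>n \<omega>. 0 \<le> Y n \<omega>"
    and sum: "summable (\<lambda>n. \<integral>\<omega>. Y n \<omega> \<partial>M)"
  shows "AE \<omega> in M. (\<lambda>n. Y n \<omega>) \<longlonglongrightarrow> 0"
proof -
  have [measurable]: "Y n \<in> borel_measurable M" for n
    using int by auto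
  have "(\<integral>\<^sup>+\<omega>. (\<Sum>n. ennreal (Y n \<omega>)) \<partial>M) = (\<Sum>n. \<integral>\<^sup>+\<omega>. ennreal (Y n \<omega>) \<partial>M)"
    by (intro nn_integral_suminf) auto
  also have "\<dots> = (\<Sum>n. ennreal (\<integral>\<omega>. Y n \<omega> \<partial>M))"
    using int nonneg by (intro suminf_cong nn_integral_eq_integral) auto
  also have "\<dots> = ennreal (\<Sum>n. \<integral>\<omega>. Y n \<omega> \<partial>M)"
    using sum nonneg by (intro suminf_ennreal2) auto
  finally have "(\<integral>\<^sup>+\<omega>. (\<Sum>n. ennreal (Y n \<omega>)) \<partial>M) \<noteq> \<infinity>"
    by simp
  then have "AE \<omega> in M. (\<Sum>n. ennreal (Y n \<omega>)) \<noteq> \<infinity>"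
    by (intro nn_integral_PInf_AE) auto
  then show ?thesis
  proof eventually_elim
    case (elim \<omega>)
    then show ?case
      using nonneg by (intro summable_LIMSEQ_zero summable_suminf_not_top) auto
  qed
qed

text \<open>Consecutive squares have ratio tending to 1, so a monotone sequence cannot stray between
  them.\<close>

lemma mono_average_tendsto_if_along_squares:
  fixes a :: "nat \<Rightarrow> real"
  assumes "mono a" and nonneg: "\<And>n. 0 \<le> a n"
    and lim: "(\<lambda>m. a (m\<^sup>2) / real (m\<^sup>2)) \<longlonglongrightarrow> p"
  shows "(\<lambda>n. a n / real n) \<longlonglongrightarrow> p"
proof -
  have root: "filterlim floor_sqrt at_top sequentially"
    unfolding filterlim_at_top le_floor_sqrt_iff by (intro allI eventually_ge_at_top)
  have ratio: "(\<lambda>m. (real m / real (Suc m))\<^sup>2) \<longlonglongrightarrow> 1\<^sup>2"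
    by (intro tendsto_power LIMSEQ_n_over_Suc_n)
  have ratio': "(\<lambda>m. (real (Suc m) / real m)\<^sup>2) \<longlonglongrightarrow> 1\<^sup>2"
    by (intro tendsto_power LIMSEQ_Suc_n_over_n)
  have "(\<lambda>m. a (m\<^sup>2) / real (m\<^sup>2) * (real m / real (Suc m))\<^sup>2) \<longlonglongrightarrow> p * 1\<^sup>2"
    by (intro tendsto_mult lim ratio)
  from filterlim_compose[OF this root]
  have lower: "(\<lambda>n. a ((floor_sqrt n)\<^sup>2) / real ((floor_sqrt n)\<^sup>2)
      * (real (floor_sqrt n) / real (Suc (floor_sqrt n)))\<^sup>2) \<longlonglongrightarrow> p"
    by simp
  have "(\<lambda>m. a ((Suc m)\<^sup>2) / real ((Suc m)\<^sup>2) * (real (Suc m) / real m)\<^sup>2) \<longlonglongrightarrow> p * 1\<^sup>2"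
    by (intro tendsto_mult LIMSEQ_Suc[OF lim] ratio')
  from filterlim_compose[OF this root]
  have upper: "(\<lambda>n. a ((Suc (floor_sqrt n))\<^sup>2) / real ((Suc (floor_sqrt n))\<^sup>2)
      * (real (Suc (floor_sqrt n)) / real (floor_sqrt n))\<^sup>2) \<longlonglongrightarrow> p"
    by simp
  show ?thesis
  proof (rule tendsto_sandwich[OF _ _ lower upper])
    show "\<forall>\<^sub>F n in sequentially. a ((floor_sqrt n)\<^sup>2) / real ((floor_sqrt n)\<^sup>2)
        * (real (floor_sqrt n) / real (Suc (floor_sqrt n)))\<^sup>2 \<le> a n / real n"
      using eventually_gt_at_top[of 0]
    proof eventually_elim
      case (elim n)
      let ?m = "floor_sqrt n"
      have m: "0 < ?m" using elim by simp
      have "real n \<le> real ((Suc ?m)\<^sup>2)"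
        using Suc_floor_sqrt_power2_gt[of n] by (intro of_nat_mono) simp
      then have "a (?m\<^sup>2) / real ((Suc ?m)\<^sup>2) \<le> a n / real n"
        using elim nonneg monoD[OF \<open>mono a\<close> floor_sqrt_power2_le[of n]] by (intro frac_le) auto
      moreover have "a (?m\<^sup>2) / real (?m\<^sup>2) * (real ?m / real (Suc ?m))\<^sup>2 = a (?m\<^sup>2) / real ((Suc ?m)\<^sup>2)"
        using m by (simp add: power_divide)
      ultimately show ?case by simp
    qed
    show "\<forall>\<^sub>F n in sequentially. a n / real n \<le> a ((Suc (floor_sqrt n))\<^sup>2) / real ((Suc (floor_sqrt n))\<^sup>2)
        * (real (Suc (floor_sqrt n)) / real (floor_sqrt n))\<^sup>2"
      using eventually_gt_at_top[of 0]
    proof eventually_elim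
      case (elim n)
      let ?m = "floor_sqrt n"
      have m: "0 < ?m" using elim by simp
      have "real (?m\<^sup>2) \<le> real n"
        by (intro of_nat_mono) simp
      moreover have "a n \<le> a ((Suc ?m)\<^sup>2)"
        using Suc_floor_sqrt_power2_gt[of n] by (intro monoD[OF \<open>mono a\<close>]) simp
      ultimately have "a n / real n \<le> a ((Suc ?m)\<^sup>2) / real (?m\<^sup>2)"
        using m nonneg by (intro frac_le) auto
      moreover have "a ((Suc ?m)\<^sup>2) / real ((Suc ?m)\<^sup>2) * (real (Suc ?m) / real ?m)\<^sup>2
          = a ((Suc ?m)\<^sup>2) / real (?m\<^sup>2)"
        by (simp add: power_divide del: of_nat_Suc)
      ultimately show ?case by simp
    qed
  qed
qed

text \<open>The mean square error of the frequency is of order \<open>1 / n\<close>, which is summable along the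
  squares. Between squares, the number of occurrences is monotone.\<close>

lemma (in prob_space) frequency_strong_law:
  fixes A :: "nat \<Rightarrow> 'a set" and c :: "nat \<Rightarrow> real"
  assumes A: "\<And>i. A i \<in> events" and p: "\<And>i. prob (A i) = p"
    and cov: "\<And>i d. \<bar>prob (A i \<inter> A (i + d)) - p * p\<bar> \<le> c d"
    and c: "summable c"
  shows "AE \<omega> in M. (\<lambda>n. (\<Sum>i=1..n. indicator (A i) \<omega>) / real n) \<longlonglongrightarrow> p"
proof -
  let ?S = "\<lambda>(n::nat) \<omega>. (\<Sum>i=1..n. indicator (A i) \<omega>) :: real"
  let ?Y = "\<lambda>m \<omega>. (?S (m\<^sup>2) \<omega> / real (m\<^sup>2) - p)\<^sup>2"
  let ?K = "2 * suminf c"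
  note [measurable] = A
  have S_bound: "\<bar>?S n \<omega>\<bar> \<le> real n" for n \<omega>
  proof -
    have "\<bar>?S n \<omega>\<bar> \<le> (\<Sum>i=1..n. \<bar>indicator (A i) \<omega>\<bar>)"
      by (rule sum_abs)
    also have "\<dots> \<le> (\<Sum>i=1..n. 1)"
      by (intro sum_mono) (auto simp: indicator_def)
    finally show ?thesis by simp
  qed
  have avg_bound: "\<bar>?S n \<omega> / real n\<bar> \<le> 1" for n \<omega>
    using S_bound[of \<omega> n] by (cases "n = 0") (auto simp: divide_simps)
  have int_Y: "integrable M (?Y m)" for m
  proof (rule integrable_const_bound[where B="(1 + \<bar>p\<bar>)\<^sup>2"])
    show "AE \<omega> in M. norm (?Y m \<omega>) \<le> (1 + \<bar>p\<bar>)\<^sup>2"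
    proof (intro AE_I2)
      fix \<omega>
      have "\<bar>?S (m\<^sup>2) \<omega> / real (m\<^sup>2) - p\<bar> \<le> \<bar>1 + \<bar>p\<bar>\<bar>"
        using avg_bound[of \<omega> "m\<^sup>2"] by linarith
      then show "norm (?Y m \<omega>) \<le> (1 + \<bar>p\<bar>)\<^sup>2"
        by (simp only: abs_le_square_iff real_norm_def abs_power2)
    qed
  qed measurable
  have EY: "expectation (?Y m) \<le> ?K * (1 / real m ^ 2)" if "0 < m" for m
  proof -
    have "?Y m \<omega> = (?S (m\<^sup>2) \<omega> - real (m\<^sup>2) * p)\<^sup>2 / (real (m\<^sup>2))\<^sup>2" for \<omega>
      using that by (simp add: field_simps)
    then have "expectation (?Y m) =
        expectation (\<lambda>\<omega>. (?S (m\<^sup>2) \<omega> - real (m\<^sup>2) * p)\<^sup>2) / (real (m\<^sup>2))\<^sup>2"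
      by simp
    also have "\<dots> \<le> real (m\<^sup>2) * ?K / (real (m\<^sup>2))\<^sup>2"
      by (intro divide_right_mono second_moment_frequency_le[OF A p cov c]) auto
    also have "\<dots> = ?K * (1 / real m ^ 2)"
      using that by (simp add: power2_eq_square)
    finally show ?thesis .
  qed
  have "summable (\<lambda>m. expectation (?Y m))"
  proof (rule summable_comparison_test_ev)
    show "\<forall>\<^sub>F m in sequentially. norm (expectation (?Y m)) \<le> ?K * (1 / real m ^ 2)"
      using eventually_gt_at_top[of 0] by eventually_elim (use EY in auto)
    show "summable (\<lambda>m. ?K * (1 / real m ^ 2))"
      using inverse_power_summable[of 2, where 'a=real]
      by (intro summable_mult) (simp add: inverse_eq_divide)
  qed
  then have "AE \<omega> in M. (\<lambda>m. ?Y m \<omega>) \<longlonglongrightarrow> 0"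
    by (intro AE_tendsto_0_if_expectations_summable int_Y) auto
  then show ?thesis
  proof eventually_elim
    case (elim \<omega>)
    have "(\<lambda>m. ?S (m\<^sup>2) \<omega> / real (m\<^sup>2) - p) \<longlonglongrightarrow> 0"
      using tendsto_real_sqrt[OF elim] by (simp only: real_sqrt_abs real_sqrt_zero tendsto_rabs_zero_iff)
    then have "(\<lambda>m. ?S (m\<^sup>2) \<omega> / real (m\<^sup>2)) \<longlonglongrightarrow> p"
      by (simp add: LIM_zero_iff)
    moreover have "mono (\<lambda>n. ?S n \<omega>)"
      by (intro monoI sum_mono2) auto
    ultimately show ?case
      by (intro mono_average_tendsto_if_along_squares) (auto intro: sum_nonneg)
  qed
qed

section \<open>From pointwise to uniform convergence of distribution functions\<close>

text \<open>Every point strictly below the quantile has distribution function below \<open>u\<close>, and the mass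
  of the open half-line is the left limit.\<close>

lemma (in cdf_distribution) measure_below_quantile:
  assumes "u \<in> {0<..<1}"
  shows "measure M {..<I u} \<le> u"
proof (rule tendsto_upperbound[OF cdf_at_left])
  have "C y \<le> u" if "y < I u" for y
    using pseudoinverse[of u y] assms that by (simp add: not_le less_imp_le)
  then show "\<forall>\<^sub>F y in at_left (I u). C y \<le> u"
    by (simp add: eventually_at_filter)
qed simp

text \<open>Given a grid of levels of mesh \<open>1 / K\<close>, let \<open>C x\<close> lie between two neighbouring levels. Then
  \<open>G n x\<close> is at least the value of \<open>G n\<close> at the lower quantile and at most the value of \<open>H n\<close> at the
  upper one. In the limit these values are at least the lower and at most the upper level. The
  grid is finite, so a single \<open>n\<close> serves all \<open>x\<close>. The function \<open>H n\<close> stands for the left limits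
  of \<open>G n\<close>.\<close>

lemma (in cdf_distribution) uniform_limit_cdf_if_at_quantiles:
  fixes G H :: "nat \<Rightarrow> real \<Rightarrow> real"
  assumes G0: "\<And>n x. 0 \<le> G n x" and G1: "\<And>n x. G n x \<le> 1"
    and G_mono: "\<And>n x y. x \<le> y \<Longrightarrow> G n x \<le> G n y"
    and GH: "\<And>n x y. x < y \<Longrightarrow> G n x \<le> H n y"
    and G_lim: "\<And>u. u \<in> \<rat> \<inter> {0<..<1} \<Longrightarrow> (\<lambda>n. G n (I u)) \<longlonglongrightarrow> C (I u)"
    and H_lim: "\<And>u. u \<in> \<rat> \<inter> {0<..<1} \<Longrightarrow> (\<lambda>n. H n (I u)) \<longlonglongrightarrow> measure M {..<I u}"
  shows "uniform_limit UNIV G C sequentially"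
proof (rule uniform_limitI)
  fix e :: real
  assume "0 < e"
  then obtain k where k: "1 / real (Suc k) < e / 2"
    using reals_Archimedean[of "e / 2"] by (auto simp: inverse_eq_divide)
  \<comment> \<open>half of \<open>e\<close> is spent on the mesh, half on the convergence at the quantiles\<close>
  define K where "K = Suc k"
  have K: "0 < K" "1 / real K < e / 2"
    using k by (auto simp: K_def)
  let ?q = "\<lambda>j. real j / real K"
  have q: "?q j \<in> \<rat> \<inter> {0<..<1}" if "0 < j" "j < K" for j
    using that by auto
  have "\<forall>\<^sub>F n in sequentially. \<forall>j\<in>{0<..<K}.
      \<bar>G n (I (?q j)) - C (I (?q j))\<bar> < e / 2 \<and> \<bar>H n (I (?q j)) - measure M {..<I (?q j)}\<bar> < e / 2"
  proof (intro eventually_ball_finite ballI eventually_conj)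
    fix j assume "j \<in> {0<..<K}"
    then show "\<forall>\<^sub>F n in sequentially. \<bar>G n (I (?q j)) - C (I (?q j))\<bar> < e / 2"
      and "\<forall>\<^sub>F n in sequentially. \<bar>H n (I (?q j)) - measure M {..<I (?q j)}\<bar> < e / 2"
      using tendstoD[OF G_lim[OF q], of j "e / 2"] tendstoD[OF H_lim[OF q], of j "e / 2"] \<open>0 < e\<close>
      by (auto simp: dist_real_def)
  qed simp
  then show "\<forall>\<^sub>F n in sequentially. \<forall>x\<in>UNIV. dist (G n x) (C x) < e"
  proof (eventually_elim, intro ballI)
    fix n x
    assume close: "\<forall>j\<in>{0<..<K}.
      \<bar>G n (I (?q j)) - C (I (?q j))\<bar> < e / 2 \<and> \<bar>H n (I (?q j)) - measure M {..<I (?q j)}\<bar> < e / 2"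
    \<comment> \<open>the levels \<open>?q j\<close> and \<open>?q (Suc j)\<close> enclose \<open>C x\<close>; where they lie strictly between 0 and 1,
        their quantiles enclose \<open>x\<close>\<close>
    define j where "j = nat \<lfloor>real K * C x\<rfloor>"
    have "0 \<le> real K * C x"
      by (simp add: cdf_nonneg)
    then have "real j \<le> real K * C x" "real K * C x < real j + 1"
      unfolding j_def by linarith+
    then have j: "?q j \<le> C x" "C x < ?q (Suc j)" and jK: "?q (Suc j) = ?q j + 1 / real K"
      using K(1) by (simp_all add: field_simps)
    have C1: "C x \<le> 1"
      by (rule cdf_bounded_prob)
    have "G n x < C x + e"
    proof (cases "Suc j < K")
      case True
      then have u: "?q (Suc j) \<in> {0<..<1}"
        using q[of "Suc j"] by simp
      have "x < I (?q (Suc j))"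
        using pseudoinverse[of "?q (Suc j)" x] u j(2) by (auto simp: not_le)
      then have "G n x \<le> H n (I (?q (Suc j)))"
        by (rule GH)
      also have "\<dots> < measure M {..<I (?q (Suc j))} + e / 2"
        using bspec[OF close, of "Suc j"] True unfolding abs_less_iff
        by (simp del: of_nat_Suc)
      also have "\<dots> \<le> ?q (Suc j) + e / 2"
        using measure_below_quantile[OF u] by simp
      finally show ?thesis
        using j(1) jK K(2) by linarith
    next
      case False
      then have "1 \<le> ?q (Suc j)"
        using K(1) by (simp add: divide_simps)
      then show ?thesis
        using G1[of n x] j(1) jK K(2) \<open>0 < e\<close> by linarith
    qed
    moreover have "C x - e < G n x"
    proof -
      \<comment> \<open>at \<open>C x = 1\<close> the level \<open>?q j = 1\<close> has no quantile and the previous level serves\<close>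
      define i where "i = (if j < K then j else K - 1)"
      have i: "i < K"
        using K(1) by (simp add: i_def)
      have qi: "?q i \<le> C x" "C x \<le> ?q i + 1 / real K"
      proof -
        have "?q i \<le> ?q j"
          using K(1) by (auto simp: i_def divide_simps)
        then show "?q i \<le> C x"
          using j(1) by linarith
        show "C x \<le> ?q i + 1 / real K"
        proof (cases "j < K")
          case True
          then show ?thesis
            using j(2) jK by (simp add: i_def)
        next
          case False
          then have "?q i + 1 / real K = 1"
            using K(1) by (simp add: i_def of_nat_diff field_simps)
          then show ?thesis
            using C1 by simp
        qed
      qed
      show ?thesis
      proof (cases "i = 0")
        case True
        then have "C x \<le> 1 / real K"
          using qi(2) by simp
        then show ?thesis
          using G0[of n x] K(2) \<open>0 < e\<close> by linarith
      next
        case False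
        then have u: "?q i \<in> {0<..<1}"
          using q[of i] i by simp
        have "I (?q i) \<le> x" and "?q i \<le> C (I (?q i))"
          using pseudoinverse[of "?q i" x] pseudoinverse[of "?q i" "I (?q i)"] u qi(1)
          by (simp_all only: greaterThanLessThan_iff order.refl simp_thms)
        moreover have "G n (I (?q i)) \<le> G n x"
          using \<open>I (?q i) \<le> x\<close> by (rule G_mono)
        moreover have "\<bar>G n (I (?q i)) - C (I (?q i))\<bar> < e / 2"
          using bspec[OF close, of i] False i by simp
        ultimately show ?thesis
          using qi(2) K(2) by linarith
      qed
    qed
    ultimately show "dist (G n x) (C x) < e"
      by (auto simp: dist_real_def abs_less_iff)
  qed
qed

lemma SUP_abs_diff_tendsto_0_if_uniform_limit:
  fixes f :: "nat \<Rightarrow> 'b \<Rightarrow> real"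
  assumes "uniform_limit UNIV f l sequentially"
  shows "(\<lambda>n. SUP x. \<bar>f n x - l x\<bar>) \<longlonglongrightarrow> 0"
proof (rule tendstoI)
  fix e :: real
  assume "0 < e"
  then have "\<forall>\<^sub>F n in sequentially. \<forall>x\<in>UNIV. dist (f n x) (l x) < e / 2"
    by (intro uniform_limitD[OF assms]) simp
  then show "\<forall>\<^sub>F n in sequentially. dist (SUP x. \<bar>f n x - l x\<bar>) 0 < e"
  proof eventually_elim
    case (elim n)
    then have le: "\<bar>f n x - l x\<bar> \<le> e / 2" for x
      by (auto simp: dist_real_def less_imp_le)
    then have "(SUP x. \<bar>f n x - l x\<bar>) \<le> e / 2"
      by (intro cSUP_least) auto
    moreover have "0 \<le> (SUP x. \<bar>f n x - l x\<bar>)"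
      using le by (intro cSUP_upper2[of _ _ undefined] bdd_aboveI[of _ "e / 2"]) auto
    ultimately show ?case
      using \<open>0 < e\<close> by (simp add: dist_real_def)
  qed
qed

section \<open>The uniform strong law for mixing sequences\<close>

text \<open>The number of visits to \<open>B\<close> falls under the general strong law for frequencies, with the
  mixing coefficients as the correlation decay.\<close>

lemma (in prob_space) stationary_frequency_strong_law:
  fixes X :: "int \<Rightarrow> 'a \<Rightarrow> real"
  assumes meas: "\<And>l. X l \<in> borel_measurable M" and stat: "stationary M X"
    and sum: "summable (beta_coeff M X t)" and B: "B \<in> sets borel"
  shows "AE \<omega> in M. (\<lambda>n. (\<Sum>i=1..n. indicator B (X (int i) \<omega>)) / real n)
           \<longlonglongrightarrow> measure (distr M borel (X 1)) B"
proof -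
  let ?A = "\<lambda>i::nat. X (int i) -` B \<inter> space M"
  let ?p = "measure (distr M borel (X 1)) B"
  have A: "?A i \<in> events" for i
    using meas B by (intro measurable_sets) auto
  have p: "prob (?A i) = ?p" for i
    using stationary_single[OF meas stat B, of "int i" 1] meas B by (simp add: measure_distr)
  have "\<bar>prob (?A i \<inter> ?A (i + d)) - ?p * ?p\<bar> \<le> beta_coeff M X t d" for i d
    using stationary_covariance_le_beta_coeff[OF meas stat B, of "int i" d t] p[of i] p[of "i + d"]
    by simp
  from frequency_strong_law[OF A p this sum] show ?thesis
  proof (rule AE_mp, intro AE_I2 impI)
    fix \<omega>
    assume "\<omega> \<in> space M" and "(\<lambda>n. (\<Sum>i=1..n. indicator (?A i) \<omega>) / real n) \<longlonglongrightarrow> ?p"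
    then show "(\<lambda>n. (\<Sum>i=1..n. indicator B (X (int i) \<omega>)) / real n) \<longlonglongrightarrow> ?p"
      by (simp add: indicator_def)
  qed
qed

theorem proposition2:
  fixes M :: "'a measure" and X :: "int \<Rightarrow> 'a \<Rightarrow> real" and t :: int and \<delta> :: real
  assumes "prob_space M"
    and "\<And>l. X l \<in> borel_measurable M"
    and "stationary M X"
    and "\<And>l. integrable M (\<lambda>\<omega>. (X l \<omega>)\<^sup>2)"
    and "beta_mixing M X t"
    and "0 < \<delta>" and "\<delta> < 1"
    and "beta_coeff M X t \<in> O(\<lambda>n. real n powr (- ((1 + \<delta>) / (1 - \<delta>))))"
  shows "AE \<omega> in M.
           (\<lambda>n. SUP x. \<bar>empirical_fun X n x \<omega> - cdf (distr M borel (X 1)) x\<bar>) \<longlonglongrightarrow> 0"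
proof -
  interpret prob_space M by fact
  interpret D: cdf_distribution "distr M borel (X 1)"
    unfolding cdf_distribution_def using assms(2) by (intro real_distribution_distr) simp
  have "- ((1 + \<delta>) / (1 - \<delta>)) < -1"
    using assms(6,7) by (simp add: field_simps)
  then have sum: "summable (beta_coeff M X t)"
    by (intro summable_comparison_test_bigo[OF _ assms(8)]) (simp add: summable_real_powr_iff)
  note law = stationary_frequency_strong_law[OF assms(2,3) sum]
  let ?H = "\<lambda>\<omega> n y. (\<Sum>i=1..n. indicator {..<y} (X (int i) \<omega>)) / real n :: real"
  have "AE \<omega> in M. \<forall>u\<in>\<rat> \<inter> {0<..<1}.
      (\<lambda>n. empirical_fun X n (D.I u) \<omega>) \<longlonglongrightarrow> D.C (D.I u) \<and>
      (\<lambda>n. ?H \<omega> n (D.I u)) \<longlonglongrightarrow> measure (distr M borel (X 1)) {..<D.I u}"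
    using law[of "{.._}"] law[of "{..<_}"]
    by (intro AE_ball_countable' AE_conjI)
       (auto simp: empirical_fun_def cdf_def intro: countable_rat countable_subset[of _ \<rat>])
  then show ?thesis
  proof eventually_elim
    case (elim \<omega>)
    have mono: "empirical_fun X n x \<omega> \<le> ?H \<omega> n y" if "x < y" for n x y
    proof -
      have "(\<Sum>i=1..n. indicator {..x} (X (int i) \<omega>))
          \<le> (\<Sum>i=1..n. indicator {..<y} (X (int i) \<omega>) :: real)"
        using that by (intro sum_mono) (auto simp: indicator_def)
      then show ?thesis
        unfolding empirical_fun_def by (simp add: divide_right_mono)
    qed
    have "(\<Sum>i=1..n. indicator {..x} (X (int i) \<omega>)) \<le> (\<Sum>i=1..n. 1 :: real)" for n x
      by (intro sum_mono) (simp add: indicator_def)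
    then have le1: "empirical_fun X n x \<omega> \<le> 1" for n x
      by (cases "n = 0") (simp_all add: empirical_fun_def divide_simps)
    have "uniform_limit UNIV (\<lambda>n x. empirical_fun X n x \<omega>) D.C sequentially"
    proof (rule D.uniform_limit_cdf_if_at_quantiles[where H="?H \<omega>"])
      show "0 \<le> empirical_fun X n x \<omega>" for n x
        unfolding empirical_fun_def by (auto intro!: sum_nonneg divide_nonneg_nonneg)
      show "empirical_fun X n x \<omega> \<le> empirical_fun X n y \<omega>" if "x \<le> y" for n x y
        using that unfolding empirical_fun_def
        by (intro mult_left_mono sum_mono) (auto simp: indicator_def)
    qed (use elim mono le1 in auto)
    then show ?case
      by (rule SUP_abs_diff_tendsto_0_if_uniform_limit)
  qed
qed

end
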